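(* Let $Z$ be a real $n\times r$ matrix with columns $z_1,\dots,z_r\in\mathbf{R}^n$ such that the zonotope $P(Z)=\{Zy: y\in\mathbf{R}^r,\ -1\le y_i\le 1,\ 1\le i\le r\}$ is an $n$-dimensional parallelotope. Let $\beta_1,\dots,\beta_r>0$ be scalars such that the system of vectors $\{\beta_iz_i:1\le i\le r\}$ is unimodular, let $Z_\beta$ be the $n\times r$ matrix whose columns are $\sqrt{2\beta_i}\,z_i$, $1\le i\le r$, and put $Q=(Z_\beta Z_\beta^T)^{-1}$. Let $D=\{\beta_iQz_i:1\le i\le r\}$, and let $L(\mathcal T)$ be the lattice of centers of the parallelotopes in the tiling by translates of $P(Z)$. Then $L(\mathcal T)$ is the dicing lattice $L(D)$: it is the set of intersection points of the family of hyperplanes $$H(j,k)=\{x\in\mathbf{R}^n: x^T(\beta_jQz_j)=k\},\qquad 1\le j\le r,\ k\in\mathbf{Z}.$$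
   Context: A parallelotope is a convex polytope whose translates fill the space $\mathbf{R}^n$ facet to facet without overlapping interiors (a tiling). The zonotope $P(Z)$ is centered at the origin. Choosing one facet $F_j$ from each pair of opposite facets of $P(Z)$, $1\le j\le m$, and writing $\frac12 t_j$ for the center of $F_j$, the translate $P(Z)+t_j$ is the parallelotope of the tiling adjacent to $P(Z)$ along $F_j$. The set $\mathcal T=\{t_j:1\le j\le m\}$ generates the lattice $L(\mathcal T)$, whose points are the centers of the parallelotopes of the tiling. A set $X$ of vectors spanning $\mathbf{R}^n$ is called unimodular if for every subset $B\subseteq X$ of $n$ linearly independent vectors, every vector of $X$ is an integer linear combination of the vectors of $B$. (When $P(Z)$ is a parallelotope, the matroid represented by the columns of $Z$ is regular, and scalars $\beta_i>0$ as in the claim exist.) For a set $D$ of vectors spanning $\mathbf{R}^n$, let $\mathcal H(D)$ be the family of hyperplanes $H(d,m)=\{x\in\mathbf{R}^n: x^Td=m\}$, $d\in D$, $m\in\mathbf{Z}$. An intersection point of the family is a point $x$ that is the unique common point of hyperplanes $H(d,m_d)$, $d\in B$, for some basis $B\subseteq D$ of $\mathbf{R}^n$ and some integers $m_d$. If $D$ is unimodular, the set of all intersection points of $\mathcal H(D)$ is a lattice, denoted $L(D)$ and called a dicing lattice. *)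

theory Defs
  imports "HOL-Analysis.Analysis" "HOL-Computational_Algebra.Group_Closure"
begin

definition zonotope :: "real ^ 'r ^ 'n \<Rightarrow> (real ^ 'n) set" where
  "zonotope Z = {Z *v y | y. \<forall>i. -1 \<le> y $ i \<and> y $ i \<le> 1}"

(* C is the set of translation vectors.  The last clause is "facet to facet": every facet of
   a tile is also a facet of another tile. *)
definition facet_to_facet_tiling :: "'a::euclidean_space set \<Rightarrow> 'a set \<Rightarrow> bool" where
  "facet_to_facet_tiling P C \<longleftrightarrow>
     (\<Union>c\<in>C. (+) c ` P) = UNIV \<and>
     (\<forall>c\<in>C. \<forall>d\<in>C. c \<noteq> d \<longrightarrow> interior ((+) c ` P) \<inter> interior ((+) d ` P) = {}) \<and>
     (\<forall>c\<in>C. \<forall>F. F facet_of (+) c ` P \<longrightarrow> (\<exists>d\<in>C. d \<noteq> c \<and> F facet_of (+) d ` P))"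

(* A polytope with empty interior could satisfy this vacuously (a point tiles by all of its
   translates), so full dimension has to be required separately. *)
definition parallelotope :: "'a::euclidean_space set \<Rightarrow> bool" where
  "parallelotope P \<longleftrightarrow> polytope P \<and> (\<exists>C. facet_to_facet_tiling P C)"

(* For a nonempty bounded set there is at most one such point. *)
definition is_center :: "'a::euclidean_space \<Rightarrow> 'a set \<Rightarrow> bool" where
  "is_center c S \<longleftrightarrow> (\<lambda>x. 2 *\<^sub>R c - x) ` S = S"

(* For P symmetric about the origin, the facet opposite to F is -F. *)
definition facet_representatives :: "'a::euclidean_space set \<Rightarrow> 'a set set \<Rightarrow> bool" where
  "facet_representatives P FF \<longleftrightarrow>
     (\<forall>F\<in>FF. F facet_of P) \<and>
     (\<forall>F. F facet_of P \<longrightarrow> (F \<in> FF) \<noteq> (uminus ` F \<in> FF))"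

definition facet_vectors :: "'a::euclidean_space set set \<Rightarrow> 'a set" where
  "facet_vectors FF = {t. \<exists>F\<in>FF. is_center ((1/2) *\<^sub>R t) F}"

definition unimodular :: "'a::euclidean_space set \<Rightarrow> bool" where
  "unimodular X \<longleftrightarrow>
     span X = UNIV \<and>
     (\<forall>B\<subseteq>X. independent B \<and> card B = DIM('a) \<longrightarrow>
        (\<forall>x\<in>X. \<exists>m :: 'a \<Rightarrow> int. x = (\<Sum>b\<in>B. of_int (m b) *\<^sub>R b)))"

definition dicing_hyperplane :: "'a::euclidean_space \<Rightarrow> int \<Rightarrow> 'a set" where
  "dicing_hyperplane d m = {x. x \<bullet> d = of_int m}"

definition intersection_points :: "'a::euclidean_space set \<Rightarrow> 'a set" where
  "intersection_points D =
     {x. \<exists>B\<subseteq>D. \<exists>m :: 'a \<Rightarrow> int. independent B \<and> span B = UNIV \<and>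
           (\<Inter>b\<in>B. dicing_hyperplane b (m b)) = {x}}"

end

theory Submission
  imports Defs
begin

text \<open>Write \<open>u i = \<beta> i z i\<close> and let \<open>gram\<close> be the map \<open>h \<mapsto> \<Sum>i. 2 \<beta> i (h \<bullet> z i) z i\<close>, whose
  inverse is \<open>Q\<close>. All three sets in the theorem are the image under \<open>gram\<close> of the lattice
  \<open>K = {h. \<forall>i. h \<bullet> u i \<in> \<int>}\<close>.

  The link is the notion of a cocircuit vector: a normal \<open>h\<close> of a hyperplane spanned by some of
  the \<open>u i\<close>, scaled so that \<open>h \<bullet> u i\<close> takes only the values \<open>-1\<close>, \<open>0\<close> and \<open>1\<close>; by unimodularity
  every such normal can be scaled in this way
  (\<open>minimal_support_imp_cocircuit_vector\<close>). Up to positive scaling, these are exactly the outer facet normals of the zonotope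
  (\<open>facet_imp_exposed_cocircuit\<close>, \<open>exposed_cocircuit_facet\<close>). The center of the facet with
  normal \<open>h\<close> is \<open>\<Sum>i. sgn (h \<bullet> z i) z i\<close>, and since \<open>sgn (h \<bullet> z i) = \<beta> i (h \<bullet> z i)\<close>, it
  is \<open>gram h / 2\<close> (\<open>is_center_exposed\<close>). So the facet vectors are, up to sign, the images of the
  cocircuit vectors. The vectors dual to a basis chosen among the \<open>u i\<close> are cocircuit vectors
  that generate \<open>K\<close>, which gives \<open>group_closure T = gram ` K\<close>
  (\<open>group_closure_facet_vectors\<close>). On the other side, \<open>gram h \<bullet> Q (u i) = h \<bullet> u i\<close>, and for a
  unimodular set the intersection points are the points integral on the whole set
  (\<open>intersection_points_eq_dual_lattice\<close>); so they too form \<open>gram ` K\<close>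
  (\<open>intersection_points_eq_lattice\<close>).

  For the set \<open>C\<close> of centers, two tiles that share a facet differ by its facet vector
  (\<open>tiling_closed_under_gram_cocircuit\<close>), so \<open>C\<close> contains the lattice. That it contains nothing
  else follows once the lattice translates of the zonotope are known to cover the space
  (\<open>lattice_translates_cover\<close>). They do because the zonotope is the Voronoi cell of the lattice
  for the quadratic form \<open>Q\<close>: its facet inequalities \<open>h \<bullet> x \<le> \<Sum>i. \<bar>h \<bullet> z i\<bar>\<close> say that
  \<open>x\<close> is no farther from \<open>0\<close> than from \<open>gram h\<close>.\<close>

section \<open>Unimodular systems and integrality\<close>

lemma unimodular_span: "unimodular X \<Longrightarrow> span X = UNIV"
  unfolding unimodular_def by (rule conjunct1)

lemma unimodular_integer_coordinates:
  fixes X :: "'a::euclidean_space set"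
  assumes "unimodular X" and "B \<subseteq> X" and "independent B" and "span B = UNIV" and "x \<in> X"
  obtains m :: "'a \<Rightarrow> int" where "x = (\<Sum>b\<in>B. of_int (m b) *\<^sub>R b)"
proof -
  have "card B = DIM('a)"
    using assms(3,4) by (metis dim_UNIV dim_eq_card_independent dim_span)
  then show ?thesis
    using assms that unfolding unimodular_def by blast
qed

lemma spanning_set_contains_basis:
  fixes X :: "'a::euclidean_space set"
  assumes "span X = UNIV"
  obtains B where "B \<subseteq> X" "independent B" "span B = UNIV" "finite B"
proof -
  obtain B where B: "B \<subseteq> X" "independent B" "X \<subseteq> span B"
    using maximal_independent_subset by blast
  then have "span B = UNIV"
    using assms by (metis span_mono span_span top.extremum_uniqueI)
  with B show ?thesis
    using that independent_imp_finite by blast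
qed

lemma orthogonal_to_spanning_set:
  fixes w :: "'a::euclidean_space"
  assumes "span X = UNIV" and "\<And>x. x \<in> X \<Longrightarrow> w \<bullet> x = 0"
  shows "w = 0"
proof -
  have "X \<subseteq> {x. w \<bullet> x = 0}"
    using assms(2) by blast
  then have "span X \<subseteq> {x. w \<bullet> x = 0}"
    by (simp add: span_minimal subspace_hyperplane)
  then have "w \<bullet> w = 0"
    using assms(1) by blast
  then show ?thesis by simp
qed

lemma span_eq_UNIV_if_no_orthogonal:
  fixes X :: "'a::euclidean_space set"
  assumes "\<And>w. (\<And>x. x \<in> X \<Longrightarrow> w \<bullet> x = 0) \<Longrightarrow> w = 0"
  shows "span X = UNIV"
proof (rule ccontr)
  assume "span X \<noteq> UNIV"
  then obtain a where "a \<noteq> 0" "span X \<subseteq> {x. a \<bullet> x = 0}"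
    using span_not_univ_subset_hyperplane by blast
  then show False
    using assms[of a] span_superset[of X] by blast
qed

text \<open>Integrality on a basis contained in a unimodular set propagates to the whole set, so a choice
  of one integer for each element of a basis already determines a point that is integral on every
  member. This is why the intersection points form a group.\<close>

lemma intersection_points_eq_dual_lattice:
  fixes X :: "'a::euclidean_space set"
  assumes "unimodular X"
  shows "intersection_points X = {x. \<forall>d\<in>X. x \<bullet> d \<in> \<int>}"
proof (intro equalityI subsetI)
  fix x assume "x \<in> intersection_points X"
  then obtain B and m :: "'a \<Rightarrow> int" where B: "B \<subseteq> X" "independent B" "span B = UNIV"
    and x: "(\<Inter>b\<in>B. dicing_hyperplane b (m b)) = {x}"
    unfolding intersection_points_def by blast
  have *: "x \<bullet> b \<in> \<int>" if "b \<in> B" for b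
  proof -
    have "x \<in> dicing_hyperplane b (m b)"
      using x that by blast
    then show ?thesis
      by (simp add: dicing_hyperplane_def)
  qed
  have "x \<bullet> d \<in> \<int>" if d: "d \<in> X" for d
  proof -
    obtain k :: "'a \<Rightarrow> int" where k: "d = (\<Sum>b\<in>B. of_int (k b) *\<^sub>R b)"
      using unimodular_integer_coordinates[OF assms B d] by blast
    show ?thesis
      unfolding k inner_sum_right inner_scaleR_right using * by (intro Ints_sum Ints_mult) auto
  qed
  then show "x \<in> {x. \<forall>d\<in>X. x \<bullet> d \<in> \<int>}" by blast
next
  fix x assume x: "x \<in> {x. \<forall>d\<in>X. x \<bullet> d \<in> \<int>}"
  have "span X = UNIV"
    using assms by (rule unimodular_span)
  then obtain B where B: "B \<subseteq> X" "independent B" "span B = UNIV" and "finite B"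
    by (rule spanning_set_contains_basis)
  have "(\<Inter>b\<in>B. dicing_hyperplane b \<lfloor>x \<bullet> b\<rfloor>) = {x}"
  proof (intro equalityI subsetI)
    fix y assume "y \<in> (\<Inter>b\<in>B. dicing_hyperplane b \<lfloor>x \<bullet> b\<rfloor>)"
    then have y: "y \<bullet> b = of_int \<lfloor>x \<bullet> b\<rfloor>" if "b \<in> B" for b
      using that by (simp add: dicing_hyperplane_def)
    have "(y - x) \<bullet> b = 0" if "b \<in> B" for b
    proof -
      have "x \<bullet> b \<in> \<int>"
        using x B(1) that by blast
      then show ?thesis
        using y[OF that] by (simp add: inner_diff_left of_int_floor)
    qed
    then have "y - x = 0"
      using orthogonal_to_spanning_set[OF B(3)] by blast
    then show "y \<in> {x}" by simp
  next
    fix y assume "y \<in> {x}"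
    moreover have "x \<bullet> b = of_int \<lfloor>x \<bullet> b\<rfloor>" if "b \<in> B" for b
      using x B(1) that by (metis (mono_tags, lifting) mem_Collect_eq of_int_floor subsetD)
    ultimately show "y \<in> (\<Inter>b\<in>B. dicing_hyperplane b \<lfloor>x \<bullet> b\<rfloor>)"
      by (simp add: dicing_hyperplane_def)
  qed
  then show "x \<in> intersection_points X"
    unfolding intersection_points_def using B by (intro CollectI exI[of _ B] conjI exI[of _ "\<lambda>b. \<lfloor>x \<bullet> b\<rfloor>"]) simp_all
qed

lemma unimodular_linear_image:
  fixes f g :: "'a::euclidean_space \<Rightarrow> 'a"
  assumes "unimodular X" and "linear f" and "linear g"
    and gf: "\<And>x. g (f x) = x" and fg: "\<And>x. f (g x) = x"
  shows "unimodular (f ` X)"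
  unfolding unimodular_def
proof (intro conjI allI impI ballI)
  show "span (f ` X) = UNIV"
    unfolding linear_span_image[OF \<open>linear f\<close>] unimodular_span[OF assms(1)]
    using fg by (metis surjI)
next
  fix B y assume B: "B \<subseteq> f ` X" and ind: "independent B \<and> card B = DIM('a)" and y: "y \<in> f ` X"
  have inj: "inj g"
    using fg by (metis injI)
  have gB: "g ` B \<subseteq> X" and gy: "g y \<in> X"
    using B y gf by auto
  have "independent (g ` B)"
    using ind \<open>linear g\<close> inj by (metis inj_on_subset linear_independent_injective_image subset_UNIV)
  moreover have "card (g ` B) = DIM('a)"
    using ind inj by (simp add: card_image inj_on_subset)
  ultimately obtain m :: "'a \<Rightarrow> int" where "g y = (\<Sum>b\<in>g ` B. of_int (m b) *\<^sub>R b)"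
    using assms(1) gB gy unfolding unimodular_def by blast
  also have "\<dots> = (\<Sum>b\<in>B. of_int (m (g b)) *\<^sub>R g b)"
    using inj by (subst sum.reindex) (auto intro: inj_on_subset)
  finally have "y = f (\<Sum>b\<in>B. of_int (m (g b)) *\<^sub>R g b)"
    using fg by metis
  also have "\<dots> = (\<Sum>b\<in>B. of_int ((m \<circ> g) b) *\<^sub>R b)"
    using fg by (simp add: linear_sum[OF \<open>linear f\<close>] linear_cmul[OF \<open>linear f\<close>])
  finally show "\<exists>m :: 'a \<Rightarrow> int. y = (\<Sum>b\<in>B. of_int (m b) *\<^sub>R b)" by blast
qed

lemma dual_basis:
  fixes B :: "'a::euclidean_space set"
  assumes "independent B"
  obtains e where "\<forall>b. \<forall>c\<in>B. e b \<bullet> c = (if c = b then 1 else 0)"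
proof -
  have "\<exists>h. \<forall>c\<in>B. h \<bullet> c = (if c = b then 1 else 0)" for b
  proof -
    obtain f :: "'a \<Rightarrow> real" where f: "linear f" "\<forall>c\<in>B. f c = (if c = b then 1 else 0)"
      using linear_independent_extend[OF assms, of "\<lambda>c. if c = b then 1 else 0"] by blast
    have "adjoint f 1 \<bullet> c = f c" for c
      using adjoint_works[OF f(1), of c 1] by (simp add: inner_commute)
    with f(2) show ?thesis
      by (intro exI[of _ "adjoint f 1"]) simp
  qed
  then have "\<exists>e. \<forall>b. \<forall>c\<in>B. e b \<bullet> c = (if c = b then 1 else 0)"
    by (intro choice allI)
  then show ?thesis
    using that by (rule exE)
qed

lemma group_closure_int_scaleR:
  fixes x :: "'a::real_vector"
  assumes "x \<in> group_closure S"
  shows "of_int k *\<^sub>R x \<in> group_closure S"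
proof -
  have nat: "of_nat n *\<^sub>R x \<in> group_closure S" for n
    by (induction n) (use assms in \<open>auto simp: algebra_simps intro: group_closure_add\<close>)
  show ?thesis
  proof (cases k)
    case (nonneg n)
    then show ?thesis using nat[of n] by simp
  next
    case (neg n)
    have "- (of_nat (Suc n) *\<^sub>R x) \<in> group_closure S"
      using nat by (simp only: group_closure_minus_iff)
    moreover have "of_int k *\<^sub>R x = - (of_nat (Suc n) *\<^sub>R x)"
      by (simp add: neg algebra_simps)
    ultimately show ?thesis by simp
  qed
qed

lemma group_closure_sum_in:
  fixes f :: "'b \<Rightarrow> 'a::real_vector"
  assumes "\<And>i. i \<in> I \<Longrightarrow> f i \<in> group_closure S"
  shows "sum f I \<in> group_closure S"
  using assms by (induction I rule: infinite_finite_induct) (auto intro: group_closure_add)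

section \<open>Translation symmetries of compact sets\<close>

text \<open>On a compact set that is mapped onto itself by a translation, the linear functional in the
  direction of the translation attains its maximum, which the translation cannot increase.\<close>

lemma compact_translation_invariant:
  fixes S :: "'a::euclidean_space set"
  assumes "compact S" and "S \<noteq> {}" and "\<And>x. x \<in> S \<Longrightarrow> v + x \<in> S"
  shows "v = 0"
proof -
  have "continuous_on S (\<lambda>x. v \<bullet> x)"
    by (intro continuous_intros)
  then obtain x where x: "x \<in> S" "\<And>y. y \<in> S \<Longrightarrow> v \<bullet> y \<le> v \<bullet> x"
    using continuous_attains_sup[OF assms(1,2)] by blast
  have "v \<bullet> (v + x) \<le> v \<bullet> x"
    using x assms(3) by blast
  then show ?thesis
    using inner_ge_zero[of v] by (simp add: inner_add_right order_antisym)
qed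

lemma is_center_unique:
  assumes "compact S" and "S \<noteq> {}" and "is_center c S" and "is_center d S"
  shows "c = d"
proof -
  have "2 *\<^sub>R (c - d) + x \<in> S" if "x \<in> S" for x
  proof -
    have "2 *\<^sub>R d - x \<in> S"
      using assms(4) that unfolding is_center_def by blast
    then have "2 *\<^sub>R c - (2 *\<^sub>R d - x) \<in> S"
      using assms(3) unfolding is_center_def by blast
    then show ?thesis by (simp add: algebra_simps)
  qed
  then have "2 *\<^sub>R (c - d) = 0"
    using compact_translation_invariant[OF assms(1,2)] by blast
  then show ?thesis by simp
qed

lemma facet_of_translation:
  fixes P :: "'a::euclidean_space set"
  shows "(+) a ` F facet_of (+) a ` P \<longleftrightarrow> F facet_of P"
  by (simp add: facet_of_def aff_dim_translation_eq)

section \<open>Cocircuit vectors of a scaled unimodular system\<close>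

locale scaled_unimodular =
  fixes z :: "'r::finite \<Rightarrow> 'a::euclidean_space" and \<beta> :: "'r \<Rightarrow> real"
  assumes beta_pos: "\<And>i. \<beta> i > 0"
    and unimodular_range: "unimodular (range (\<lambda>i. \<beta> i *\<^sub>R z i))"
begin

definition u :: "'r \<Rightarrow> 'a" where
  "u i = \<beta> i *\<^sub>R z i"

lemma unimodular_u: "unimodular (range u)"
  using unimodular_range by (simp add: u_def[abs_def])

lemma span_u: "span (range u) = UNIV"
  using unimodular_u by (rule unimodular_span)

lemma inner_u: "h \<bullet> u i = \<beta> i * (h \<bullet> z i)"
  by (simp add: u_def)

lemma inner_u_eq_0_iff: "h \<bullet> u i = 0 \<longleftrightarrow> h \<bullet> z i = 0"
  using beta_pos[of i] by (simp add: inner_u)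

lemma nonzero_imp_inner_u_nonzero:
  assumes "h \<noteq> 0"
  obtains j where "h \<bullet> u j \<noteq> 0"
  using assms orthogonal_to_spanning_set[OF span_u] by blast

text \<open>The clause with \<open>g\<close> says that the \<open>u i\<close> orthogonal to \<open>h\<close> span the hyperplane orthogonal
  to \<open>h\<close>, that is, that the support of the vector of the products \<open>h \<bullet> u i\<close> is a cocircuit of the
  matroid of the system. The other clauses fix the scale of \<open>h\<close> up to a sign.\<close>

definition cocircuit_vector :: "'a \<Rightarrow> bool" where
  "cocircuit_vector h \<longleftrightarrow> h \<noteq> 0 \<and> (\<forall>i. h \<bullet> u i \<in> {-1, 0, 1}) \<and>
     (\<forall>g. (\<forall>i. h \<bullet> u i = 0 \<longrightarrow> g \<bullet> u i = 0) \<longrightarrow> (\<exists>a. g = a *\<^sub>R h))"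

lemma cocircuit_vector_uminus:
  assumes "cocircuit_vector h"
  shows "cocircuit_vector (- h)"
  unfolding cocircuit_vector_def
proof (intro conjI allI impI)
  show "- h \<noteq> 0" and "\<And>i. - h \<bullet> u i \<in> {- 1, 0, 1}"
    using assms by (fastforce simp: cocircuit_vector_def)+
  fix g assume "\<forall>i. - h \<bullet> u i = 0 \<longrightarrow> g \<bullet> u i = 0"
  then obtain a where "g = a *\<^sub>R h"
    using assms unfolding cocircuit_vector_def by auto
  then have "g = (- a) *\<^sub>R (- h)" by simp
  then show "\<exists>a. g = a *\<^sub>R (- h)" by blast
qed

text \<open>The members of the system orthogonal to \<open>h\<close> together with the single \<open>u j\<close> span the
  space, so every \<open>u i\<close> is an integer combination of a basis consisting of \<open>u j\<close> and vectors orthogonal to \<open>h\<close>.\<close>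

lemma minimal_support_ratio_integer:
  assumes min: "\<And>g. (\<And>i. h \<bullet> u i = 0 \<Longrightarrow> g \<bullet> u i = 0) \<Longrightarrow> \<exists>a. g = a *\<^sub>R h"
    and j: "h \<bullet> u j \<noteq> 0"
  obtains k :: int where "h \<bullet> u i = of_int k * (h \<bullet> u j)"
proof -
  let ?X = "insert (u j) {x \<in> range u. h \<bullet> x = 0}"
  have "span ?X = UNIV"
  proof (rule span_eq_UNIV_if_no_orthogonal)
    fix w assume w: "\<And>x. x \<in> ?X \<Longrightarrow> w \<bullet> x = 0"
    then obtain a where a: "w = a *\<^sub>R h"
      using min[of w] by blast
    have "w \<bullet> u j = 0"
      using w by blast
    with a j show "w = 0" by simp
  qed
  then obtain B where B: "B \<subseteq> ?X" "independent B" "span B = UNIV" "finite B"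
    by (rule spanning_set_contains_basis)
  have "B \<subseteq> range u"
    using B(1) by blast
  then obtain m :: "'a \<Rightarrow> int" where m: "u i = (\<Sum>b\<in>B. of_int (m b) *\<^sub>R b)"
    using unimodular_integer_coordinates[OF unimodular_u _ B(2,3)] by blast
  have "h \<bullet> u i = (\<Sum>b\<in>B. of_int (m b) * (h \<bullet> b))"
    by (simp add: m inner_sum_right)
  also have "\<dots> = (\<Sum>b\<in>B. if b = u j then of_int (m b) * (h \<bullet> b) else 0)"
    using B(1) by (intro sum.cong) auto
  also have "\<dots> = of_int (if u j \<in> B then m (u j) else 0) * (h \<bullet> u j)"
    using B(4) by (simp add: sum.delta)
  finally show ?thesis
    using that by blast
qed

text \<open>The ratio and its inverse are both integers, so a nonzero ratio is \<open>1\<close> or \<open>-1\<close>.\<close>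

lemma minimal_support_imp_cocircuit_vector:
  assumes min: "\<And>g. (\<And>i. h \<bullet> u i = 0 \<Longrightarrow> g \<bullet> u i = 0) \<Longrightarrow> \<exists>a. g = a *\<^sub>R h"
    and j: "h \<bullet> u j \<noteq> 0"
  shows "cocircuit_vector ((1 / (h \<bullet> u j)) *\<^sub>R h)"
  unfolding cocircuit_vector_def
proof (intro conjI allI impI)
  show "(1 / (h \<bullet> u j)) *\<^sub>R h \<noteq> 0"
    using j by auto
next
  fix i
  show "(1 / (h \<bullet> u j)) *\<^sub>R h \<bullet> u i \<in> {-1, 0, 1}"
  proof (cases "h \<bullet> u i = 0")
    case False
    obtain k :: int where k: "h \<bullet> u i = of_int k * (h \<bullet> u j)"
      using minimal_support_ratio_integer[OF min j] by metis
    obtain l :: int where l: "h \<bullet> u j = of_int l * (h \<bullet> u i)"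
      using minimal_support_ratio_integer[OF min False] by metis
    have "of_int (k * l) * (h \<bullet> u j) = h \<bullet> u j"
      using k l by (simp add: algebra_simps)
    then have "k * l = 1"
      using j by (metis mult_cancel_right1 of_int_eq_1_iff)
    then have "k = 1 \<or> k = -1"
      using zmult_eq_1_iff by blast
    then show ?thesis
      using k j by auto
  qed simp
next
  fix g assume "\<forall>i. (1 / (h \<bullet> u j)) *\<^sub>R h \<bullet> u i = 0 \<longrightarrow> g \<bullet> u i = 0"
  then obtain a where "g = a *\<^sub>R h"
    using min[of g] j by auto
  then have "g = (a * (h \<bullet> u j)) *\<^sub>R (1 / (h \<bullet> u j)) *\<^sub>R h"
    using j by simp
  then show "\<exists>a. g = a *\<^sub>R (1 / (h \<bullet> u j)) *\<^sub>R h" by blast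
qed

text \<open>A vector vanishing on the rest of the basis is determined by its product with the one
  remaining element, so the support of a dual basis vector is minimal.\<close>

lemma dual_basis_vector_cocircuit:
  assumes B: "B \<subseteq> range u" "independent B" "span B = UNIV" and b: "b \<in> B"
    and h: "\<And>c. c \<in> B \<Longrightarrow> h \<bullet> c = (if c = b then 1 else 0)"
  shows "cocircuit_vector h"
proof -
  obtain j where j: "b = u j"
    using B b by blast
  have 1: "h \<bullet> u j = 1"
    using h[OF b] j by simp
  have "\<exists>a. g = a *\<^sub>R h" if g: "\<And>i. h \<bullet> u i = 0 \<Longrightarrow> g \<bullet> u i = 0" for g
  proof -
    have "(g - (g \<bullet> b) *\<^sub>R h) \<bullet> c = 0" if c: "c \<in> B" for c
    proof (cases "c = b")
      case True
      then show ?thesis using h[OF b] by (simp add: inner_diff_left)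
    next
      case False
      moreover obtain i where "c = u i" using B c by blast
      ultimately show ?thesis
        using h[OF c] g[of i] by (simp add: inner_diff_left)
    qed
    then have "g - (g \<bullet> b) *\<^sub>R h = 0"
      using orthogonal_to_spanning_set[OF B(3)] by blast
    then show ?thesis by auto
  qed
  then have "cocircuit_vector ((1 / (h \<bullet> u j)) *\<^sub>R h)"
    using 1 by (intro minimal_support_imp_cocircuit_vector) auto
  then show ?thesis by (simp add: 1)
qed

text \<open>Two proportional cocircuit vectors agree up to sign, as all nonzero products are \<open>1\<close> or
  \<open>-1\<close>.\<close>

lemma cocircuit_vector_unique:
  assumes h: "cocircuit_vector h" and g: "cocircuit_vector g"
    and zero: "\<And>i. h \<bullet> u i = 0 \<Longrightarrow> g \<bullet> u i = 0"
  shows "g = h \<or> g = - h"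
proof -
  obtain a where a: "g = a *\<^sub>R h"
    using h zero unfolding cocircuit_vector_def by blast
  obtain j where j: "g \<bullet> u j \<noteq> 0"
    using g nonzero_imp_inner_u_nonzero unfolding cocircuit_vector_def by blast
  have "g \<bullet> u j \<in> {-1, 0, 1}" "h \<bullet> u j \<in> {-1, 0, 1}"
    using g h unfolding cocircuit_vector_def by blast+
  with j a have "a = 1 \<or> a = -1"
    by auto
  with a show ?thesis by auto
qed

section \<open>Facets of the zonotope\<close>

definition P :: "'a set" where
  "P = {(\<Sum>i\<in>UNIV. y i *\<^sub>R z i) | y. \<forall>i. \<bar>y i\<bar> \<le> 1}"

definition support :: "'a \<Rightarrow> real" where
  "support h = (\<Sum>i\<in>UNIV. \<bar>h \<bullet> z i\<bar>)"

definition exposed :: "'a \<Rightarrow> 'a set" where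
  "exposed h = P \<inter> {x. h \<bullet> x = support h}"

text \<open>In the matrix notation this is \<open>Zb Zb\<^sup>T h\<close>, for \<open>Zb\<close> with the columns
  \<open>sqrt (2 \<beta> i) z i\<close>.\<close>

definition gram :: "'a \<Rightarrow> 'a" where
  "gram h = (\<Sum>i\<in>UNIV. (2 * \<beta> i * (h \<bullet> z i)) *\<^sub>R z i)"

lemma linear_gram: "linear gram"
  by (rule linearI)
    (simp_all add: gram_def inner_add_left algebra_simps sum.distrib scaleR_sum_right)

lemma polytope_P: "polytope P"
proof -
  let ?f = "\<lambda>y :: real ^ 'r. \<Sum>i\<in>UNIV. (y $ i) *\<^sub>R z i"
  have "linear ?f"
    by (rule linearI) (simp_all add: algebra_simps sum.distrib scaleR_sum_right)
  then have "polytope (?f ` cbox (-1) 1)"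
    by (intro polytope_linear_image polytope_interval)
  moreover have "P = ?f ` cbox (-1) 1"
  proof (intro equalityI subsetI)
    fix x assume "x \<in> P"
    then obtain y where y: "x = (\<Sum>i\<in>UNIV. y i *\<^sub>R z i)" "\<forall>i. \<bar>y i\<bar> \<le> 1"
      unfolding P_def by blast
    then have "x = ?f (\<chi> i. y i)" "(\<chi> i. y i) \<in> cbox (-1) 1"
      by (simp_all add: mem_box_cart abs_le_iff minus_le_iff)
    then show "x \<in> ?f ` cbox (-1) 1" by blast
  next
    fix x assume "x \<in> ?f ` cbox (-1) 1"
    then obtain y where y: "x = ?f y" "y \<in> cbox (-1) 1" by blast
    then have "\<forall>i. \<bar>y $ i\<bar> \<le> 1"
      by (simp add: mem_box_cart abs_le_iff minus_le_iff)
    with y show "x \<in> P"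
      unfolding P_def by blast
  qed
  ultimately show ?thesis by simp
qed

lemmas compact_P = polytope_imp_compact[OF polytope_P]
  and convex_P = polytope_imp_convex[OF polytope_P]
  and polyhedron_P = polytope_imp_polyhedron[OF polytope_P]

lemma uminus_P: "x \<in> P \<Longrightarrow> - x \<in> P"
proof -
  assume "x \<in> P"
  then obtain y where y: "x = (\<Sum>i\<in>UNIV. y i *\<^sub>R z i)" "\<forall>i. \<bar>y i\<bar> \<le> 1"
    unfolding P_def by blast
  then show ?thesis
    unfolding P_def by (intro CollectI exI[of _ "\<lambda>i. - y i"]) (simp add: sum_negf)
qed

lemma affine_hull_P: "affine hull P = UNIV"
proof -
  have "0 \<in> P"
    unfolding P_def by (intro CollectI exI[of _ "\<lambda>_. 0"]) simp
  then have "affine hull P = span P"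
    by (simp add: affine_hull_span_0 hull_inc)
  moreover have "u j \<in> span P" for j
  proof -
    have "z j = (\<Sum>i\<in>UNIV. (if i = j then 1 else 0) *\<^sub>R z i)"
      by (simp add: if_distrib[of "\<lambda>x. x *\<^sub>R _"] cong: if_cong)
    then have "z j \<in> P"
      unfolding P_def by (intro CollectI exI[of _ "\<lambda>i. if i = j then 1 else 0"]) simp
    then show ?thesis
      unfolding u_def by (simp add: span_base span_scale)
  qed
  then have "span (range u) \<subseteq> span P"
    by (intro span_minimal) auto
  ultimately show ?thesis
    using span_u by auto
qed

lemma aff_dim_P: "aff_dim P = int (DIM('a))"
  using affine_hull_P by (metis aff_dim_UNIV aff_dim_affine_hull)

lemma zero_in_interior_P: "0 \<in> interior P"
proof -
  have "P \<noteq> {}"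
    using affine_hull_P by auto
  then have "interior P \<noteq> {}"
    using affine_hull_P convex_P rel_interior_eq_empty rel_interior_interior by blast
  then obtain x where x: "x \<in> interior P" by blast
  have "uminus ` P = P"
    using uminus_P by (auto simp: image_iff) (metis add.inverse_inverse)
  then have "uminus ` interior P = interior P"
    by (metis interior_negations)
  then have "- x \<in> interior P"
    using x by (metis imageI)
  then have "(1/2) *\<^sub>R x + (1/2) *\<^sub>R (- x) \<in> interior P"
    using x convex_interior[OF convex_P] by (intro convexD) auto
  then show ?thesis by simp
qed

lemma inner_le_support: "x \<in> P \<Longrightarrow> h \<bullet> x \<le> support h"
proof -
  assume "x \<in> P"
  then obtain y where y: "x = (\<Sum>i\<in>UNIV. y i *\<^sub>R z i)" "\<forall>i. \<bar>y i\<bar> \<le> 1"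
    unfolding P_def by blast
  have "y i * (h \<bullet> z i) \<le> \<bar>h \<bullet> z i\<bar>" for i
  proof -
    have "y i * (h \<bullet> z i) \<le> \<bar>y i\<bar> * \<bar>h \<bullet> z i\<bar>"
      by (metis abs_ge_self abs_mult)
    also have "\<dots> \<le> \<bar>h \<bullet> z i\<bar>"
      using y(2) by (simp add: mult_left_le_one_le)
    finally show ?thesis .
  qed
  then show ?thesis
    by (simp add: y(1) support_def inner_sum_right sum_mono)
qed

text \<open>Equality in the support inequality forces equality in every summand.\<close>

lemma exposed_iff:
  "x \<in> exposed h \<longleftrightarrow> (\<exists>y. x = (\<Sum>i\<in>UNIV. y i *\<^sub>R z i) \<and> (\<forall>i. \<bar>y i\<bar> \<le> 1) \<and>
     (\<forall>i. h \<bullet> z i \<noteq> 0 \<longrightarrow> y i = sgn (h \<bullet> z i)))"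
proof
  assume "x \<in> exposed h"
  then obtain y where y: "x = (\<Sum>i\<in>UNIV. y i *\<^sub>R z i)" "\<forall>i. \<bar>y i\<bar> \<le> 1"
    and x: "h \<bullet> x = support h"
    unfolding exposed_def P_def by blast
  have le: "y i * (h \<bullet> z i) \<le> \<bar>h \<bullet> z i\<bar>" for i
    using y(2) by (metis abs_ge_self abs_ge_zero abs_mult mult_left_le_one_le order_trans)
  have "(\<Sum>i\<in>UNIV. \<bar>h \<bullet> z i\<bar> - y i * (h \<bullet> z i)) = 0"
    using x by (simp add: y(1) support_def inner_sum_right sum_subtractf)
  then have eq: "y i * (h \<bullet> z i) = \<bar>h \<bullet> z i\<bar>" for i
    using le by (subst (asm) sum_nonneg_eq_0_iff) auto
  have "y i = sgn (h \<bullet> z i)" if "h \<bullet> z i \<noteq> 0" for i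
    using eq[of i] that by (metis abs_sgn mult.commute mult_cancel_right)
  with y show "\<exists>y. x = (\<Sum>i\<in>UNIV. y i *\<^sub>R z i) \<and> (\<forall>i. \<bar>y i\<bar> \<le> 1) \<and>
      (\<forall>i. h \<bullet> z i \<noteq> 0 \<longrightarrow> y i = sgn (h \<bullet> z i))"
    by blast
next
  assume "\<exists>y. x = (\<Sum>i\<in>UNIV. y i *\<^sub>R z i) \<and> (\<forall>i. \<bar>y i\<bar> \<le> 1) \<and>
      (\<forall>i. h \<bullet> z i \<noteq> 0 \<longrightarrow> y i = sgn (h \<bullet> z i))"
  then obtain y where y: "x = (\<Sum>i\<in>UNIV. y i *\<^sub>R z i)" "\<forall>i. \<bar>y i\<bar> \<le> 1"
    and sg: "\<And>i. h \<bullet> z i \<noteq> 0 \<Longrightarrow> y i = sgn (h \<bullet> z i)"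
    by blast
  have "y i * (h \<bullet> z i) = \<bar>h \<bullet> z i\<bar>" for i
    using sg[of i] by (cases "h \<bullet> z i = 0") (auto simp: abs_sgn mult.commute)
  then have "h \<bullet> x = support h"
    by (simp add: y(1) support_def inner_sum_right)
  then show "x \<in> exposed h"
    using y unfolding exposed_def P_def by blast
qed

lemma exposed_uminus: "exposed (- h) = uminus ` exposed h"
proof -
  have "support (- h) = support h"
    by (simp add: support_def)
  then have "x \<in> exposed (- h) \<longleftrightarrow> - x \<in> exposed h" for x
    using uminus_P[of x] uminus_P[of "- x"] by (auto simp: exposed_def)
  then show ?thesis
    by (force simp: image_iff)
qed

lemma compact_exposed: "compact (exposed h)"
  unfolding exposed_def by (intro compact_Int_closed compact_P closed_hyperplane)

lemma support_pos: "h \<noteq> 0 \<Longrightarrow> support h > 0"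
proof -
  assume "h \<noteq> 0"
  then obtain j where "h \<bullet> z j \<noteq> 0"
    using nonzero_imp_inner_u_nonzero inner_u_eq_0_iff by metis
  then have "0 < (\<Sum>i\<in>UNIV. \<bar>h \<bullet> z i\<bar>)"
    by (intro sum_pos2[of _ j]) auto
  then show ?thesis
    by (simp add: support_def)
qed

text \<open>The scaling makes \<open>\<beta> i * (h \<bullet> z i)\<close> the sign of \<open>h \<bullet> z i\<close>, and the point whose
  coefficients are these signs is the center of the exposed face.\<close>

lemma sgn_cocircuit_vector:
  assumes "cocircuit_vector h"
  shows "sgn (h \<bullet> z i) = \<beta> i * (h \<bullet> z i)"
proof -
  have *: "\<beta> i * (h \<bullet> z i) \<in> {-1, 0, 1}"
    using assms unfolding cocircuit_vector_def inner_u by blast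
  have "sgn (h \<bullet> z i) = sgn (\<beta> i * (h \<bullet> z i))"
    using beta_pos[of i] by (simp add: sgn_mult)
  also have "\<dots> = \<beta> i * (h \<bullet> z i)"
    using * by auto
  finally show ?thesis .
qed

lemma half_gram_cocircuit_vector:
  assumes "cocircuit_vector h"
  shows "(1/2) *\<^sub>R gram h = (\<Sum>i\<in>UNIV. sgn (h \<bullet> z i) *\<^sub>R z i)"
  using sgn_cocircuit_vector[OF assms]
  by (simp add: gram_def scaleR_sum_right mult.assoc)

lemma half_gram_in_exposed:
  assumes "cocircuit_vector h"
  shows "(1/2) *\<^sub>R gram h \<in> exposed h"
  unfolding half_gram_cocircuit_vector[OF assms] exposed_iff
  by (intro exI[of _ "\<lambda>i. sgn (h \<bullet> z i)"]) (auto simp: sgn_if)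

lemma is_center_exposed:
  assumes h: "cocircuit_vector h"
  shows "is_center ((1/2) *\<^sub>R gram h) (exposed h)"
proof -
  let ?s = "\<lambda>x. 2 *\<^sub>R ((1/2) *\<^sub>R gram h) - x"
  have *: "?s x \<in> exposed h" if x: "x \<in> exposed h" for x
  proof -
    obtain y where y: "x = (\<Sum>i\<in>UNIV. y i *\<^sub>R z i)" "\<forall>i. \<bar>y i\<bar> \<le> 1"
      and sg: "\<And>i. h \<bullet> z i \<noteq> 0 \<Longrightarrow> y i = sgn (h \<bullet> z i)"
      using x unfolding exposed_iff by blast
    let ?y = "\<lambda>i. 2 * sgn (h \<bullet> z i) - y i"
    have 1: "?s x = (\<Sum>i\<in>UNIV. ?y i *\<^sub>R z i)"
      unfolding half_gram_cocircuit_vector[OF h] y(1)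
      by (simp add: scaleR_sum_right sum_subtractf scaleR_diff_left)
    have 2: "\<forall>i. h \<bullet> z i \<noteq> 0 \<longrightarrow> ?y i = sgn (h \<bullet> z i)"
      using sg by auto
    have 3: "\<bar>?y i\<bar> \<le> 1" for i
      using sg[of i] y(2) by (cases "h \<bullet> z i = 0") (auto simp: sgn_if)
    show ?thesis
      unfolding exposed_iff using 1 2 3 by (intro exI[of _ ?y]) blast
  qed
  show ?thesis
    unfolding is_center_def
  proof (intro equalityI subsetI)
    fix x assume "x \<in> exposed h"
    then show "x \<in> ?s ` exposed h"
      using *[of x] by (intro image_eqI[of _ _ "?s x"]) auto
  qed (use * in blast)
qed

lemma half_gram_shift_in_exposed:
  assumes h: "cocircuit_vector h" and j: "h \<bullet> u j = 0"
  shows "(1/2) *\<^sub>R gram h + z j \<in> exposed h"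
proof -
  let ?y = "\<lambda>i. sgn (h \<bullet> z i) + (if i = j then 1 else 0)"
  have hz: "h \<bullet> z j = 0"
    using j by (simp add: inner_u_eq_0_iff)
  have "(1/2) *\<^sub>R gram h + z j = (\<Sum>i\<in>UNIV. ?y i *\<^sub>R z i)"
    unfolding half_gram_cocircuit_vector[OF h]
    by (simp add: scaleR_add_left sum.distrib if_distrib[of "\<lambda>x. x *\<^sub>R _"] cong: if_cong)
  moreover have "\<bar>?y i\<bar> \<le> 1" for i
    using hz by (auto simp: sgn_if)
  moreover have "\<forall>i. h \<bullet> z i \<noteq> 0 \<longrightarrow> ?y i = sgn (h \<bullet> z i)"
    using hz by auto
  ultimately show ?thesis
    unfolding exposed_iff by (intro exI[of _ ?y]) blast
qed

text \<open>Let \<open>a\<close> be an outer normal of the facet. If \<open>g\<close> vanishes on all generators orthogonal to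
  \<open>a\<close>, then \<open>g\<close> is constant on the facet, because the other coefficients are fixed there. The
  facet affinely spans a hyperplane orthogonal to \<open>a\<close>, so \<open>g\<close> is a multiple of \<open>a\<close>.\<close>

lemma facet_imp_exposed_cocircuit:
  assumes F: "F facet_of P"
  obtains h where "cocircuit_vector h" "F = exposed h"
proof -
  obtain a b where a: "a \<noteq> 0" and sub: "P \<subseteq> {x. a \<bullet> x \<le> b}" and Feq: "F = P \<inter> {x. a \<bullet> x = b}"
    using facet_of_polyhedron[OF polyhedron_P F] by blast
  have ne: "F \<noteq> {}"
    using F by (simp add: facet_of_def)
  let ?c = "\<Sum>i\<in>UNIV. sgn (a \<bullet> z i) *\<^sub>R z i"
  have "?c \<in> exposed a"
    unfolding exposed_iff by (intro exI[of _ "\<lambda>i. sgn (a \<bullet> z i)"]) (auto simp: sgn_if)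
  then have "support a \<le> b"
    using sub unfolding exposed_def by auto
  moreover have "b \<le> support a"
    using ne inner_le_support unfolding Feq by blast
  ultimately have Fa: "F = exposed a"
    unfolding Feq exposed_def by auto
  have hull: "affine hull F = {x. a \<bullet> x = b}"
  proof (rule affine_dim_equal)
    show "affine hull F \<subseteq> {x. a \<bullet> x = b}"
      unfolding Feq by (intro hull_minimal affine_hyperplane) auto
    show "aff_dim (affine hull F) = aff_dim {x. a \<bullet> x = b}"
      using F a by (simp add: facet_of_def aff_dim_P aff_dim_hyperplane)
  qed (use ne in \<open>auto simp: affine_hyperplane\<close>)
  have min: "\<exists>t. g = t *\<^sub>R a" if g: "\<And>i. a \<bullet> u i = 0 \<Longrightarrow> g \<bullet> u i = 0" for g
  proof -
    have const: "g \<bullet> x = g \<bullet> ?c" if x: "x \<in> F" for x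
    proof -
      obtain y where y: "x = (\<Sum>i\<in>UNIV. y i *\<^sub>R z i)"
        and sg: "\<And>i. a \<bullet> z i \<noteq> 0 \<Longrightarrow> y i = sgn (a \<bullet> z i)"
        using x unfolding Fa exposed_iff by blast
      have "y i * (g \<bullet> z i) = sgn (a \<bullet> z i) * (g \<bullet> z i)" for i
        using sg[of i] g[of i] by (cases "a \<bullet> z i = 0") (auto simp: inner_u_eq_0_iff)
      then show ?thesis
        unfolding y inner_sum_right inner_scaleR_right by (intro sum.cong refl)
    qed
    have "affine hull F \<subseteq> {x. g \<bullet> x = g \<bullet> ?c}"
      using const by (intro hull_minimal affine_hyperplane) auto
    then have g_const: "g \<bullet> x = g \<bullet> ?c" if "a \<bullet> x = b" for x
      using that hull by blast
    let ?w = "g - ((a \<bullet> g) / (a \<bullet> a)) *\<^sub>R a"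
    obtain p where p: "a \<bullet> p = b"
      using ne Feq by blast
    have aw: "a \<bullet> ?w = 0"
      using a by (simp add: inner_diff_right)
    then have "a \<bullet> (p + ?w) = b"
      using p by (simp add: inner_add_right)
    then have "g \<bullet> (p + ?w) = g \<bullet> p"
      using g_const p by metis
    then have "g \<bullet> ?w = 0"
      by (simp add: inner_add_right)
    then have "?w \<bullet> ?w = 0"
      using aw by (simp add: inner_diff_left)
    then have "g = ((a \<bullet> g) / (a \<bullet> a)) *\<^sub>R a"
      by simp
    then show ?thesis by blast
  qed
  obtain j where j: "a \<bullet> u j \<noteq> 0"
    using nonzero_imp_inner_u_nonzero[OF a] by blast
  \<comment> \<open>The scaling factor has to be positive for \<open>F\<close> to lie on the side of its outer normal.\<close>
  let ?h = "(1 / \<bar>a \<bullet> u j\<bar>) *\<^sub>R a"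
  have "cocircuit_vector ?h"
  proof (cases "a \<bullet> u j > 0")
    case True
    then show ?thesis using minimal_support_imp_cocircuit_vector[OF min j] by simp
  next
    case False
    then show ?thesis
      using cocircuit_vector_uminus[OF minimal_support_imp_cocircuit_vector[OF min j]] by simp
  qed
  moreover have "F = exposed ?h"
  proof -
    have "support ?h = (1 / \<bar>a \<bullet> u j\<bar>) * support a"
      by (simp add: support_def abs_mult sum_divide_distrib)
    then show ?thesis
      unfolding Fa exposed_def using j by auto
  qed
  ultimately show ?thesis
    using that by blast
qed

text \<open>The face contains its center and the translates of the center by every generator orthogonal
  to \<open>h\<close>, which span the hyperplane orthogonal to \<open>h\<close>.\<close>

lemma exposed_cocircuit_facet:
  assumes h: "cocircuit_vector h"
  shows "exposed h facet_of P"
proof -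
  let ?c = "(1/2) *\<^sub>R gram h"
  have h0: "h \<noteq> 0"
    using h by (simp add: cocircuit_vector_def)
  have c: "?c \<in> exposed h"
    using half_gram_in_exposed[OF h] .
  have face: "exposed h face_of P"
    unfolding exposed_def
    using inner_le_support by (intro face_of_Int_supporting_hyperplane_le convex_P)
  let ?X = "{u i | i. h \<bullet> u i = 0}"
  have "span (insert h ?X) = UNIV"
  proof (rule span_eq_UNIV_if_no_orthogonal)
    fix w assume w: "\<And>x. x \<in> insert h ?X \<Longrightarrow> w \<bullet> x = 0"
    then have "\<forall>i. h \<bullet> u i = 0 \<longrightarrow> w \<bullet> u i = 0" by blast
    then obtain a where a: "w = a *\<^sub>R h"
      using h unfolding cocircuit_vector_def by blast
    have "w \<bullet> h = 0"
      using w by blast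
    with a h0 show "w = 0" by simp
  qed
  then have "dim (insert h ?X) = DIM('a)"
    by (simp only: dim_eq_full)
  then have "DIM('a) \<le> dim ?X + 1"
    using dim_insert[of h ?X] by (auto split: if_splits)
  moreover have "dim ?X \<le> dim ((+) (- ?c) ` exposed h)"
  proof -
    have "u i \<in> span ((+) (- ?c) ` exposed h)" if "h \<bullet> u i = 0" for i
    proof -
      have "z i \<in> (+) (- ?c) ` exposed h"
        using half_gram_shift_in_exposed[OF h that] by (intro image_eqI[of _ _ "?c + z i"]) auto
      then show ?thesis
        unfolding u_def by (simp add: span_base span_scale)
    qed
    then have "?X \<subseteq> span ((+) (- ?c) ` exposed h)" by blast
    then show ?thesis
      by (rule dim_mono)
  qed
  moreover have "aff_dim (exposed h) = int (dim ((+) (- ?c) ` exposed h))"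
    using c by (intro aff_dim_eq_dim) (simp add: hull_inc)
  moreover have "aff_dim (exposed h) \<le> int (DIM('a)) - 1"
  proof -
    have "aff_dim (exposed h) \<le> aff_dim {x. h \<bullet> x = support h}"
      unfolding exposed_def by (intro aff_dim_subset) auto
    then show ?thesis
      using h0 by (simp add: aff_dim_hyperplane)
  qed
  ultimately have "aff_dim (exposed h) = aff_dim P - 1"
    unfolding aff_dim_P by linarith
  then show ?thesis
    using face c unfolding facet_of_def by blast
qed

text \<open>The segment from \<open>0\<close> to a point outside \<open>P\<close> leaves \<open>P\<close> through a facet, and the
  point violates the inequality of that facet since \<open>0\<close> is an interior point.\<close>

lemma in_P_if_cocircuit_inequalities:
  assumes le: "\<And>h. cocircuit_vector h \<Longrightarrow> h \<bullet> p \<le> support h"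
  shows "p \<in> P"
proof (rule ccontr)
  assume p: "p \<notin> P"
  then have "p \<noteq> 0"
    using zero_in_interior_P interior_subset by blast
  then obtain d where d: "0 < d" "d *\<^sub>R p \<in> frontier P"
    and int: "\<And>e. 0 \<le> e \<Longrightarrow> e < d \<Longrightarrow> e *\<^sub>R p \<in> interior P"
    using ray_to_frontier[OF compact_imp_bounded[OF compact_P] zero_in_interior_P] by auto
  have "d \<le> 1"
    using int[of 1] p interior_subset by force
  moreover have dP: "d *\<^sub>R p \<in> P"
    using d(2) frontier_subset_closed[OF compact_imp_closed[OF compact_P]] by blast
  ultimately have "d < 1"
    using p by (cases "d = 1") auto
  have "d *\<^sub>R p \<in> P - rel_interior P"
    using d(2) dP affine_hull_P by (simp add: rel_interior_interior frontier_def)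
  then obtain F where F: "F facet_of P" "d *\<^sub>R p \<in> F"
    using rel_boundary_of_polyhedron[OF polyhedron_P] by blast
  then obtain h where h: "cocircuit_vector h" "F = exposed h"
    using facet_imp_exposed_cocircuit by blast
  have "d * (h \<bullet> p) = support h"
    using F(2) h(2) by (simp add: exposed_def)
  moreover have "support h > 0"
    using h(1) support_pos by (simp add: cocircuit_vector_def)
  ultimately have "h \<bullet> p > 0"
    using d(1) by (metis zero_less_mult_pos)
  then have "d * (h \<bullet> p) < h \<bullet> p"
    using \<open>d < 1\<close> by simp
  then show False
    using le[OF h(1)] \<open>d * (h \<bullet> p) = support h\<close> by simp
qed

section \<open>The lattice and the tiling\<close>

definition center_lattice :: "'a set" where
  "center_lattice = gram ` {h. \<forall>i. h \<bullet> u i \<in> \<int>}"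

lemma inner_gram: "v \<bullet> gram w = (\<Sum>i\<in>UNIV. 2 * \<beta> i * (w \<bullet> z i) * (v \<bullet> z i))"
  by (simp add: gram_def inner_sum_right)

lemma inner_gram_commute: "v \<bullet> gram w = gram v \<bullet> w"
  by (simp add: inner_gram inner_commute[of "gram v" w] mult.commute mult.left_commute)

text \<open>This embedding turns the quadratic form \<open>h \<bullet> gram h\<close> into the squared Euclidean norm,
  so that a nearest lattice point for the form exists by closedness of the image.\<close>

definition gram_root :: "'a \<Rightarrow> real ^ 'r" where
  "gram_root h = (\<chi> i. sqrt (2 * \<beta> i) * (h \<bullet> z i))"

lemma linear_gram_root: "linear gram_root"
  by (rule linearI) (simp_all add: gram_root_def vec_eq_iff inner_add_left algebra_simps)

lemma inner_gram_root: "gram_root v \<bullet> gram_root w = v \<bullet> gram w"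
proof -
  have "gram_root v \<bullet> gram_root w
      = (\<Sum>i\<in>UNIV. (sqrt (2 * \<beta> i) * sqrt (2 * \<beta> i)) * ((w \<bullet> z i) * (v \<bullet> z i)))"
    unfolding gram_root_def inner_vec_def by (intro sum.cong) (simp_all add: algebra_simps)
  also have "\<dots> = v \<bullet> gram w"
    unfolding inner_gram using beta_pos by (intro sum.cong) (simp_all add: less_imp_le)
  finally show ?thesis .
qed

lemma inj_gram_root: "inj gram_root"
proof (subst linear_injective_0[OF linear_gram_root], intro allI impI)
  fix h assume "gram_root h = 0"
  then have "sqrt (2 * \<beta> i) * (h \<bullet> z i) = 0" for i
    by (metis gram_root_def vec_lambda_beta zero_index)
  then have "h \<bullet> u i = 0" for i
    using beta_pos[of i] by (metis inner_u_eq_0_iff less_numeral_extra(3) mult_eq_0_iff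
        mult_pos_pos real_sqrt_gt_zero zero_less_numeral)
  then show "h = 0"
    using nonzero_imp_inner_u_nonzero by metis
qed

lemma inj_gram: "inj gram"
proof (subst linear_injective_0[OF linear_gram], intro allI impI)
  fix h assume "gram h = 0"
  then have "gram_root h \<bullet> gram_root h = 0"
    by (simp add: inner_gram_root)
  then show "h = 0"
    using inj_gram_root linear_injective_0[OF linear_gram_root] by auto
qed

lemma gram_cocircuit_support:
  assumes "cocircuit_vector h"
  shows "h \<bullet> gram h = 2 * support h"
proof -
  have "2 * \<beta> i * (h \<bullet> z i) * (h \<bullet> z i) = 2 * \<bar>h \<bullet> z i\<bar>" for i
    using sgn_cocircuit_vector[OF assms, of i] by (metis abs_sgn mult.assoc mult.commute)
  then show ?thesis
    unfolding inner_gram support_def sum_distrib_left by (intro sum.cong refl)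
qed

text \<open>The preimage of \<open>P\<close> under \<open>gram\<close> is the Voronoi cell of the dual lattice of the system
  for the quadratic form \<open>h \<bullet> gram h\<close>: when \<open>h\<close> is a cocircuit vector, the bisector of \<open>0\<close> and \<open>h\<close>
  is the preimage of the hyperplane carrying the facet with normal \<open>h\<close>, because \<open>h \<bullet> gram h = 2 support h\<close>.
  Hence subtracting a nearest lattice point moves any point into \<open>P\<close>.\<close>

lemma lattice_translates_cover:
  obtains l where "l \<in> center_lattice" "x - l \<in> P"
proof -
  let ?K = "{h. \<forall>i. h \<bullet> u i \<in> \<int>}"
  have "surj gram"
    using linear_injective_imp_surjective[OF linear_gram inj_gram] by simp
  then obtain v where v: "x = gram v" by blast
  have "?K = (\<Inter>i. (\<lambda>h. h \<bullet> u i) -` \<int>)" by auto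
  moreover have "closed \<dots>"
    by (intro closed_INT ballI continuous_closed_vimage closed_Ints continuous_intros)
  ultimately have "closed ?K" by simp
  then have "closed (gram_root ` ?K)"
    by (intro closed_injective_linear_image linear_gram_root inj_gram_root)
  moreover have "0 \<in> ?K"
    by simp
  then have "gram_root ` ?K \<noteq> {}"
    by blast
  ultimately obtain w where "w \<in> gram_root ` ?K"
    and near: "\<And>y. y \<in> gram_root ` ?K \<Longrightarrow> dist (gram_root v) w \<le> dist (gram_root v) y"
    using distance_attains_inf[of "gram_root ` ?K" "gram_root v"] by blast
  then obtain k where k: "\<forall>i. k \<bullet> u i \<in> \<int>" "w = gram_root k" by blast
  have "h \<bullet> (x - gram k) \<le> support h" if h: "cocircuit_vector h" for h
  proof -
    have "h \<bullet> u i \<in> \<int>" for i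
    proof -
      have "h \<bullet> u i \<in> {-1, 0, 1}"
        using h unfolding cocircuit_vector_def by blast
      then show ?thesis by (auto intro: Ints_minus)
    qed
    then have "k + h \<in> ?K"
      using k(1) by (auto simp: inner_add_left)
    then have "dist (gram_root v) (gram_root k) \<le> dist (gram_root v) (gram_root (k + h))"
      using near k(2) by blast
    then have "norm (gram_root (v - k)) \<le> norm (gram_root (v - k) - gram_root h)"
      by (simp add: dist_norm linear_diff[OF linear_gram_root] linear_add[OF linear_gram_root]
          diff_diff_eq)
    then have "2 * (gram_root (v - k) \<bullet> gram_root h) \<le> gram_root h \<bullet> gram_root h"
      by (simp add: norm_le inner_diff_left inner_diff_right
          inner_commute[of "gram_root h" "gram_root (v - k)"])
    then have "2 * (gram (v - k) \<bullet> h) \<le> 2 * support h"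
      unfolding inner_gram_root gram_cocircuit_support[OF h] inner_gram_commute[of "v - k" h] .
    then show ?thesis
      by (simp add: v linear_diff[OF linear_gram] inner_commute)
  qed
  then have "x - gram k \<in> P"
    by (rule in_P_if_cocircuit_inequalities)
  then show ?thesis
    using that k(1) unfolding center_lattice_def by blast
qed

text \<open>The facet \<open>F = c + exposed h\<close> is also \<open>d + exposed g\<close>. Moving the
  center of \<open>F\<close> by a generator orthogonal to \<open>h\<close> stays in \<open>F\<close>, so \<open>g\<close> vanishes on these
  generators and minimality of supports gives \<open>g = h\<close> or
  \<open>g = - h\<close>; the first would make \<open>exposed h\<close> invariant under a nonzero translation, and the
  second says that \<open>(d - c) / 2\<close> is the center of \<open>exposed h\<close>.\<close>

lemma tiling_closed_under_gram_cocircuit: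
  assumes C: "facet_to_facet_tiling P C" and c: "c \<in> C" and h: "cocircuit_vector h"
  shows "c + gram h \<in> C"
proof -
  have "(+) c ` exposed h facet_of (+) c ` P"
    using exposed_cocircuit_facet[OF h] by (simp add: facet_of_translation)
  then obtain d where d: "d \<in> C" "d \<noteq> c" "(+) c ` exposed h facet_of (+) d ` P"
    using C c unfolding facet_to_facet_tiling_def by blast
  have "(+) c ` exposed h = (+) d ` (+) (c - d) ` exposed h"
    by (simp add: image_image)
  then have "(+) (c - d) ` exposed h facet_of P"
    using d(3) facet_of_translation by metis
  then obtain g where g: "cocircuit_vector g" and eq: "(+) (c - d) ` exposed h = exposed g"
    using facet_imp_exposed_cocircuit by metis
  have "g \<bullet> u i = 0" if i: "h \<bullet> u i = 0" for i
  proof -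
    have "(c - d) + (1/2) *\<^sub>R gram h \<in> exposed g"
      using half_gram_in_exposed[OF h] eq by blast
    moreover have "(c - d) + ((1/2) *\<^sub>R gram h + z i) \<in> exposed g"
      using half_gram_shift_in_exposed[OF h i] eq by blast
    ultimately have "g \<bullet> z i = 0"
      by (simp add: exposed_def inner_add_right)
    then show ?thesis
      by (simp add: inner_u_eq_0_iff)
  qed
  then consider "g = h" | "g = - h"
    using cocircuit_vector_unique[OF h g] by blast
  then show ?thesis
  proof cases
    case 1
    then have "c - d = 0"
      using compact_translation_invariant[OF compact_exposed[of h]] half_gram_in_exposed[OF h] eq
      by (metis empty_iff imageI)
    with d(2) show ?thesis by simp
  next
    case 2
    have "(\<lambda>x. (d - c) - x) ` exposed h = uminus ` (+) (c - d) ` exposed h"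
      by (simp add: image_image algebra_simps)
    also have "\<dots> = exposed h"
      unfolding eq 2 exposed_uminus by (simp add: image_image)
    finally have "is_center ((1/2) *\<^sub>R (d - c)) (exposed h)"
      by (simp add: is_center_def)
    then have "(1/2) *\<^sub>R (d - c) = (1/2) *\<^sub>R gram h"
      using is_center_unique[OF compact_exposed] half_gram_in_exposed[OF h] is_center_exposed[OF h]
      by blast
    then have "d - c = gram h"
      by simp
    then have "d = c + gram h"
      by (simp add: algebra_simps)
    with d(1) show ?thesis by simp
  qed
qed

lemma facet_vectors_gram:
  assumes FF: "facet_representatives P FF" and t: "t \<in> facet_vectors FF"
  obtains h where "cocircuit_vector h" "t = gram h"
proof -
  obtain F where F: "F \<in> FF" "is_center ((1/2) *\<^sub>R t) F"
    using t unfolding facet_vectors_def by blast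
  then have "F facet_of P"
    using FF unfolding facet_representatives_def by blast
  then obtain h where h: "cocircuit_vector h" "F = exposed h"
    using facet_imp_exposed_cocircuit by blast
  then have "(1/2) *\<^sub>R t = (1/2) *\<^sub>R gram h"
    using F(2) is_center_unique[OF compact_exposed] half_gram_in_exposed is_center_exposed by blast
  then show ?thesis
    using that h(1) by simp
qed

lemma gram_cocircuit_in_group_closure:
  assumes FF: "facet_representatives P FF" and h: "cocircuit_vector h"
  shows "gram h \<in> group_closure (facet_vectors FF)"
proof -
  have *: "gram g \<in> group_closure (facet_vectors FF)"
    if "cocircuit_vector g" "exposed g \<in> FF" for g
    using that is_center_exposed unfolding facet_vectors_def
    by (intro group_closure.base) blast
  have "exposed h \<in> FF \<or> exposed (- h) \<in> FF"
    using FF exposed_cocircuit_facet[OF h] unfolding facet_representatives_def exposed_uminus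
    by blast
  then show ?thesis
  proof
    assume "exposed (- h) \<in> FF"
    then have "gram (- h) \<in> group_closure (facet_vectors FF)"
      using * cocircuit_vector_uminus[OF h] by blast
    then show ?thesis
      by (simp add: linear_neg[OF linear_gram])
  qed (use * h in blast)
qed

text \<open>Each \<open>h\<close> with integral products is the combination, with the integral coefficients
  \<open>h \<bullet> b\<close>, of the vectors dual to a basis taken from the system, and these are cocircuit
  vectors.\<close>

lemma group_closure_facet_vectors:
  assumes FF: "facet_representatives P FF"
  shows "group_closure (facet_vectors FF) = center_lattice"
proof (intro equalityI subsetI)
  fix t assume "t \<in> group_closure (facet_vectors FF)"
  then show "t \<in> center_lattice"
  proof (induction rule: group_closure.induct)
    case (base s)
    then consider "s = gram 0" | h where "cocircuit_vector h" "s = gram h"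
      using facet_vectors_gram[OF FF] linear_0[OF linear_gram] by auto
    then show ?case
    proof cases
      case 2
      have "h \<bullet> u i \<in> {-1, 0, 1}" for i
        using 2 unfolding cocircuit_vector_def by blast
      then have "h \<bullet> u i \<in> \<int>" for i
        using Ints_minus[OF Ints_1] by (metis Ints_0 Ints_1 empty_iff insert_iff)
      with 2 show ?thesis
        unfolding center_lattice_def by blast
    qed (auto simp: center_lattice_def)
  next
    case (diff s t)
    then obtain h g where "s = gram h" "t = gram g" "\<forall>i. h \<bullet> u i \<in> \<int>" "\<forall>i. g \<bullet> u i \<in> \<int>"
      unfolding center_lattice_def by blast
    then have "s - t = gram (h - g)" "\<forall>i. (h - g) \<bullet> u i \<in> \<int>"
      by (auto simp: linear_diff[OF linear_gram] inner_diff_left)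
    then show ?case
      unfolding center_lattice_def by blast
  qed
next
  fix t assume "t \<in> center_lattice"
  then obtain h where h: "t = gram h" "\<And>i. h \<bullet> u i \<in> \<int>"
    unfolding center_lattice_def by blast
  obtain B where B: "B \<subseteq> range u" "independent B" "span B = UNIV" "finite B"
    by (rule spanning_set_contains_basis[OF span_u])
  obtain e where "\<forall>b. \<forall>c\<in>B. e b \<bullet> c = (if c = b then 1 else 0)"
    by (rule dual_basis[OF B(2)])
  then have e: "e b \<bullet> c = (if c = b then 1 else 0)" if "c \<in> B" for b c
    using that by blast
  have "(h - (\<Sum>b\<in>B. (h \<bullet> b) *\<^sub>R e b)) \<bullet> c = 0" if "c \<in> B" for c
    using that B(4)
    by (simp add: inner_diff_left inner_sum_left e if_distrib[of "\<lambda>x. _ * x"] cong: if_cong)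
  then have "h - (\<Sum>b\<in>B. (h \<bullet> b) *\<^sub>R e b) = 0"
    using orthogonal_to_spanning_set[OF B(3)] by blast
  then have "t = gram (\<Sum>b\<in>B. (h \<bullet> b) *\<^sub>R e b)"
    by (simp add: h(1))
  also have "\<dots> = (\<Sum>b\<in>B. (h \<bullet> b) *\<^sub>R gram (e b))"
    by (simp add: linear_sum[OF linear_gram] linear_cmul[OF linear_gram])
  also have "\<dots> \<in> group_closure (facet_vectors FF)"
  proof (rule group_closure_sum_in)
    fix b assume b: "b \<in> B"
    then have "cocircuit_vector (e b)"
      using dual_basis_vector_cocircuit[OF B(1-3)] e by blast
    then have *: "gram (e b) \<in> group_closure (facet_vectors FF)"
      by (rule gram_cocircuit_in_group_closure[OF FF])
    have "h \<bullet> b \<in> \<int>"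
      using h(2) b B(1) by blast
    then obtain k where "h \<bullet> b = of_int k"
      by (rule Ints_cases)
    with * show "(h \<bullet> b) *\<^sub>R gram (e b) \<in> group_closure (facet_vectors FF)"
      by (simp add: group_closure_int_scaleR)
  qed
  finally show "t \<in> group_closure (facet_vectors FF)" .
qed

text \<open>Facet adjacency alone puts the lattice into \<open>C\<close>. Conversely, the lattice translates
  already cover the space, so the interior of a tile with any other center would meet the
  interior of a lattice tile.\<close>

lemma tiling_eq_lattice:
  assumes C: "facet_to_facet_tiling P C" and 0: "0 \<in> C" and FF: "facet_representatives P FF"
  shows "C = center_lattice"
proof
  have "c + t \<in> C \<and> c - t \<in> C" if "t \<in> group_closure (facet_vectors FF)" "c \<in> C" for c t
    using that
  proof (induction arbitrary: c rule: group_closure.induct)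
    case (base s)
    then consider "s = 0" | h where "cocircuit_vector h" "s = gram h"
      using facet_vectors_gram[OF FF] by auto
    then show ?case
    proof cases
      case 2
      then show ?thesis
        using tiling_closed_under_gram_cocircuit[OF C base(2), of h]
          tiling_closed_under_gram_cocircuit[OF C base(2) cocircuit_vector_uminus, of h]
        by (simp add: linear_neg[OF linear_gram])
    qed (use base in simp)
  next
    case (diff s t)
    have "c + s - t \<in> C" "c - s + t \<in> C"
      using diff.IH diff.prems by blast+
    then show ?case
      by (simp add: algebra_simps)
  qed
  then show sub: "center_lattice \<subseteq> C"
    using 0 group_closure_facet_vectors[OF FF] by force
  show "C \<subseteq> center_lattice"
  proof
    fix c assume c: "c \<in> C"
    obtain l where l: "l \<in> center_lattice" "c - l \<in> P"
      using lattice_translates_cover by blast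
    have "c \<in> interior ((+) c ` P)"
      using zero_in_interior_P by (force simp: interior_translation)
    moreover have "c \<in> closure (interior ((+) l ` P))"
    proof -
      have "c - l \<in> closure (interior P)"
        using l(2) convex_closure_interior[OF convex_P] zero_in_interior_P closure_subset by blast
      then show ?thesis
        unfolding interior_translation closure_translation
        by (intro image_eqI[of _ _ "c - l"]) auto
    qed
    ultimately have "interior ((+) c ` P) \<inter> interior ((+) l ` P) \<noteq> {}"
      using open_Int_closure_eq_empty[OF open_interior] by blast
    then have "c = l"
      using C c l(1) sub unfolding facet_to_facet_tiling_def by blast
    with l(1) show "c \<in> center_lattice" by simp
  qed
qed

text \<open>A point \<open>gram h\<close> has product \<open>h \<bullet> u i\<close> with \<open>q (u i)\<close>, since \<open>q\<close> inverts the
  self-adjoint map \<open>gram\<close>; this turns the lattice into the dual lattice of \<open>q ` range u\<close>.\<close>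

lemma intersection_points_eq_lattice:
  assumes q: "linear q" "\<And>x. q (gram x) = x" "\<And>x. gram (q x) = x"
  shows "unimodular (q ` range u)" and "intersection_points (q ` range u) = center_lattice"
proof -
  show uni: "unimodular (q ` range u)"
    using unimodular_linear_image[OF unimodular_u q(1) linear_gram q(3,2)] .
  have inner: "gram h \<bullet> q (u i) = h \<bullet> u i" for h i
    by (simp add: inner_gram_commute[symmetric] q(3))
  have "{x. \<forall>d\<in>q ` range u. x \<bullet> d \<in> \<int>} = center_lattice"
  proof (intro equalityI subsetI)
    fix x assume "x \<in> {x. \<forall>d\<in>q ` range u. x \<bullet> d \<in> \<int>}"
    then have "\<forall>i. q x \<bullet> u i \<in> \<int>"
      using inner[of "q x"] by (auto simp: q(3))
    then show "x \<in> center_lattice"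
      unfolding center_lattice_def using q(3)[of x] by (intro image_eqI[of _ _ "q x"]) simp_all
  qed (auto simp: center_lattice_def inner)
  then show "intersection_points (q ` range u) = center_lattice"
    by (simp add: intersection_points_eq_dual_lattice[OF uni])
qed

end

section \<open>The dicing lattice of a parallelotopal zonotope\<close>

lemma zonotope_eq_column_sums:
  fixes Z :: "real ^ 'r ^ 'n"
  shows "zonotope Z = {(\<Sum>i\<in>UNIV. y i *\<^sub>R column i Z) | y. \<forall>i. \<bar>y i\<bar> \<le> 1}"
proof (intro equalityI subsetI)
  fix x assume "x \<in> zonotope Z"
  then obtain y :: "real ^ 'r" where y: "x = Z *v y" "\<forall>i. -1 \<le> y $ i \<and> y $ i \<le> 1"
    unfolding zonotope_def by blast
  have "x = (\<Sum>i\<in>UNIV. y $ i *\<^sub>R column i Z)"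
    by (simp add: y(1) matrix_mult_sum scalar_mult_eq_scaleR)
  moreover have "\<forall>i. \<bar>y $ i\<bar> \<le> 1"
    using y(2) by (simp add: abs_le_iff minus_le_iff)
  ultimately show "x \<in> {(\<Sum>i\<in>UNIV. y i *\<^sub>R column i Z) | y. \<forall>i. \<bar>y i\<bar> \<le> 1}" by blast
next
  fix x assume "x \<in> {(\<Sum>i\<in>UNIV. y i *\<^sub>R column i Z) | y. \<forall>i. \<bar>y i\<bar> \<le> 1}"
  then obtain y where y: "x = (\<Sum>i\<in>UNIV. y i *\<^sub>R column i Z)" "\<forall>i. \<bar>y i\<bar> \<le> 1" by blast
  have "x = Z *v (\<chi> i. y i)"
    by (simp add: y(1) matrix_mult_sum scalar_mult_eq_scaleR)
  moreover have "\<forall>i. -1 \<le> (\<chi> i. y i) $ i \<and> (\<chi> i. y i) $ i \<le> 1"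
    using y(2) by (simp add: abs_le_iff minus_le_iff)
  ultimately show "x \<in> zonotope Z"
    unfolding zonotope_def by blast
qed

theorem mainTheorem3:
  fixes Z Zb :: "real ^ 'r ^ 'n"
    and \<beta> :: "'r \<Rightarrow> real"
    and Q :: "real ^ 'n ^ 'n"
    and C T D :: "(real ^ 'n) set"
    and FF :: "(real ^ 'n) set set"
  assumes "parallelotope (zonotope Z)"
    and "aff_dim (zonotope Z) = int CARD('n)"
    and "\<And>i. \<beta> i > 0"
    and "unimodular (range (\<lambda>i. \<beta> i *\<^sub>R column i Z))"
    and "Zb = (\<chi> k i. sqrt (2 * \<beta> i) * Z $ k $ i)"
    and "Q = matrix_inv (Zb ** transpose Zb)"
    and "D = range (\<lambda>i. \<beta> i *\<^sub>R (Q *v column i Z))"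
    and "facet_to_facet_tiling (zonotope Z) C" and "0 \<in> C"
    and "facet_representatives (zonotope Z) FF"
    and "T = facet_vectors FF"
  shows "unimodular D \<and> group_closure T = intersection_points D \<and> C = intersection_points D"
proof -
  interpret scaled_unimodular "\<lambda>i. column i Z" \<beta>
    by unfold_locales (fact assms)+
  have P: "P = zonotope Z"
    by (simp add: P_def zonotope_eq_column_sums)
  have gram: "(Zb ** transpose Zb) *v h = gram h" for h
  proof -
    have comp: "(transpose Zb *v h) $ i = sqrt (2 * \<beta> i) * (h \<bullet> column i Z)" for i
      by (simp add: assms(5) matrix_vector_mult_def transpose_def column_def inner_vec_def
          sum_distrib_left mult_ac)
    have col: "column i Zb = sqrt (2 * \<beta> i) *\<^sub>R column i Z" for i
      by (simp add: assms(5) column_def vec_eq_iff)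
    have sq: "sqrt (2 * \<beta> i) * (h \<bullet> column i Z) * sqrt (2 * \<beta> i)
        = 2 * \<beta> i * (h \<bullet> column i Z)" for i
    proof -
      have "sqrt (2 * \<beta> i) * sqrt (2 * \<beta> i) = 2 * \<beta> i"
        using beta_pos[of i] by simp
      then show ?thesis
        by (metis mult.assoc mult.commute)
    qed
    have "(Zb ** transpose Zb) *v h = Zb *v (transpose Zb *v h)"
      by (simp only: matrix_vector_mul_assoc)
    also have "\<dots> = (\<Sum>i\<in>UNIV. (transpose Zb *v h) $ i *\<^sub>R column i Zb)"
      by (simp add: matrix_mult_sum scalar_mult_eq_scaleR)
    also have "\<dots> = gram h"
      unfolding comp col gram_def scaleR_scaleR sq ..
    finally show ?thesis .
  qed
  then have "inj ((*v) (Zb ** transpose Zb))"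
    using inj_gram by (simp add: inj_def)
  then have "invertible (Zb ** transpose Zb)"
    by (simp add: invertible_left_inverse matrix_left_invertible_injective)
  then have "(Zb ** transpose Zb) ** Q = mat 1 \<and> Q ** (Zb ** transpose Zb) = mat 1"
    unfolding assms(6) matrix_inv_def invertible_def by (rule someI_ex)
  then have inv: "Q ** (Zb ** transpose Zb) = mat 1" "(Zb ** transpose Zb) ** Q = mat 1"
    by blast+
  have Qg: "Q *v gram x = x" and gQ: "gram (Q *v x) = x" for x
    using inv by (simp_all only: gram[symmetric] matrix_vector_mul_assoc matrix_vector_mul_lid)
  have D: "D = (*v) Q ` range u"
    by (auto simp: assms(7) u_def matrix_vector_mult_scaleR image_image)
  note dicing = intersection_points_eq_lattice[OF matrix_vector_mul_linear Qg gQ, folded D]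
  have "group_closure T = center_lattice"
    using group_closure_facet_vectors assms(10,11) P by simp
  moreover have "C = center_lattice"
    using tiling_eq_lattice[of C FF] assms(8-10) P by simp
  ultimately show ?thesis
    using dicing by simp
qed

end
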